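(* For every $\alpha \ge 1$, if there is a polynomial-time $\alpha$-approximation algorithm for (the optimization version of) STAR, then there is a polynomial-time $\alpha$-approximation algorithm for VERTEX COVER.
   Context: All graphs are simple. The STAR problem (optimization version): given a simple graph $G=(V,E)$ and a non-empty subset of edges $X\subseteq E$, find a cycle, not necessarily simple, of minimum length that covers $X$. A cycle (not necessarily simple) is a closed walk, possibly consisting of a single vertex (length $0$); its length is the number of edges counting repetitions. A cycle covers $X$ if every edge of $X$ has an endpoint among the cycle's vertices. VERTEX COVER: given a simple graph, find a minimum-cardinality set of vertices meeting every edge. An $\alpha$-approximation algorithm for a minimization problem returns a feasible solution of value at most $\alpha$ times the optimum. *)

theory Defs
  imports Complex_Main "HOL-Computational_Algebra.Polynomial"
begin

section \<open>Deterministic multi-tape Turing machines\<close>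

datatype move = Go_Left | Stay | Go_Right

text \<open>
  Tape symbols and control states are initial segments of the natural numbers.
  Symbol 0 is the blank, 1 and 2 stand for the two bits. The machine starts in
  state 0 and halts upon entering the state \<open>tm_states M\<close>, which is
  not counted among the \<open>tm_states M\<close> working states.
\<close>

record tm =
  tm_tapes :: nat
  tm_symbols :: nat
  tm_states :: nat
  tm_trans :: "nat \<Rightarrow> nat list \<Rightarrow> nat \<times> (nat \<times> move) list"

definition wf_tm :: "tm \<Rightarrow> bool" where
  "wf_tm M \<longleftrightarrow> 2 \<le> tm_tapes M \<and> 3 \<le> tm_symbols M \<and>
    (\<forall>q < tm_states M. \<forall>xs. length xs = tm_tapes M \<and> set xs \<subseteq> {..<tm_symbols M} \<longrightarrow>
      (case tm_trans M q xs of (q', as) \<Rightarrow>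
        q' \<le> tm_states M \<and> length as = tm_tapes M \<and> fst ` set as \<subseteq> {..<tm_symbols M}))"

text \<open>A tape is infinite in both directions and comes with its head position.\<close>

type_synonym tape = "int \<times> (int \<Rightarrow> nat)"
type_synonym config = "nat \<times> tape list"

fun move_head :: "move \<Rightarrow> int \<Rightarrow> int" where
  "move_head Go_Left h = h - 1"
| "move_head Stay h = h"
| "move_head Go_Right h = h + 1"

fun act :: "nat \<times> move \<Rightarrow> tape \<Rightarrow> tape" where
  "act (a, m) (h, f) = (move_head m h, f(h := a))"

fun step :: "tm \<Rightarrow> config \<Rightarrow> config" where
  "step M (q, ts) =
    (if q < tm_states M
     then case tm_trans M q (map (\<lambda>(h, f). f h) ts) of (q', as) \<Rightarrow> (q', map2 act as ts)
     else (q, ts))"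

definition word_tape :: "bool list \<Rightarrow> int \<Rightarrow> nat" where
  "word_tape x i =
    (if 0 \<le> i \<and> i < int (length x) then (if x ! nat i then 2 else 1) else 0)"

definition init_config :: "tm \<Rightarrow> bool list \<Rightarrow> config" where
  "init_config M x = (0, (0, word_tape x) # replicate (tm_tapes M - 1) (0, \<lambda>_. 0))"

definition run :: "tm \<Rightarrow> bool list \<Rightarrow> nat \<Rightarrow> config" where
  "run M x t = (step M ^^ t) (init_config M x)"

definition halted :: "tm \<Rightarrow> config \<Rightarrow> bool" where
  "halted M c \<longleftrightarrow> fst c = tm_states M"

text \<open>The input is on tape 0, the output on tape 1; output head position is irrelevant.\<close>

definition has_output :: "config \<Rightarrow> bool list \<Rightarrow> bool" where
  "has_output c y \<longleftrightarrow> snd (snd c ! 1) = word_tape y"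


section \<open>Minimization problems and approximation algorithms\<close>

text \<open>
  \<open>solution_codes P S\<close> is the set of all words accepted as a description
  of the solution \<open>S\<close>.
\<close>

record ('i, 's) min_problem =
  instances :: "'i set"
  feasible :: "'i \<Rightarrow> 's set"
  cost :: "'i \<Rightarrow> 's \<Rightarrow> nat"
  instance_code :: "'i \<Rightarrow> bool list"
  solution_codes :: "'s \<Rightarrow> bool list set"

definition optimum :: "('i, 's) min_problem \<Rightarrow> 'i \<Rightarrow> nat" where
  "optimum P I = Inf (cost P I ` feasible P I)"

text \<open>
  The running time is bounded by a polynomial in the input length on every instance.
  On an instance without feasible solutions there is nothing to be
  returned, and the output is unconstrained.
\<close>

definition poly_time_approx_algorithm ::
  "real \<Rightarrow> ('i, 's) min_problem \<Rightarrow> tm \<Rightarrow> bool" where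
  "poly_time_approx_algorithm \<alpha> P M \<longleftrightarrow> wf_tm M \<and>
    (\<exists>p :: nat poly. \<forall>I \<in> instances P. \<exists>t \<le> poly p (length (instance_code P I)).
      halted M (run M (instance_code P I) t) \<and>
      (feasible P I \<noteq> {} \<longrightarrow>
        (\<exists>S \<in> feasible P I. \<exists>y \<in> solution_codes P S.
          has_output (run M (instance_code P I) t) y \<and>
          real (cost P I S) \<le> \<alpha> * real (optimum P I))))"

definition has_poly_time_approx :: "real \<Rightarrow> ('i, 's) min_problem \<Rightarrow> bool" where
  "has_poly_time_approx \<alpha> P \<longleftrightarrow> (\<exists>M. poly_time_approx_algorithm \<alpha> P M)"


section \<open>Simple graphs and their encoding\<close>

text \<open>
  As an algorithm's input, a finite graph has the vertex set \<open>{..<n}\<close>;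
  edges are two-element sets of vertices.
\<close>

definition simple_graph :: "nat \<Rightarrow> nat set set \<Rightarrow> bool" where
  "simple_graph n E \<longleftrightarrow> (\<forall>e \<in> E. e \<subseteq> {..<n} \<and> card e = 2)"

text \<open>
  The adjacency matrix, row by row. The number of vertices is written in unary
  in front of the matrices, so that the codes below are uniquely decodable.
\<close>

definition matrix_code :: "nat \<Rightarrow> nat set set \<Rightarrow> bool list" where
  "matrix_code n E = concat (map (\<lambda>i. map (\<lambda>j. {i, j} \<in> E) [0..<n]) [0..<n])"

definition vertex_code :: "nat \<Rightarrow> bool list" where
  "vertex_code v = replicate v True @ [False]"

definition vertices_code :: "nat list \<Rightarrow> bool list" where
  "vertices_code vs = concat (map vertex_code vs)"


section \<open>The two problems\<close>

definition covers :: "nat set \<Rightarrow> nat set set \<Rightarrow> bool" where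
  "covers S X \<longleftrightarrow> (\<forall>e \<in> X. e \<inter> S \<noteq> {})"

text \<open>
  A closed walk is given by its vertex sequence, with the start vertex repeated at the
  end; the walk \<open>[v]\<close> consists of a single vertex. A walk with vertex
  sequence \<open>w\<close> has \<open>length w - 1\<close> edges.
\<close>

definition closed_walk :: "nat \<Rightarrow> nat set set \<Rightarrow> nat list \<Rightarrow> bool" where
  "closed_walk n E w \<longleftrightarrow>
    w \<noteq> [] \<and> set w \<subseteq> {..<n} \<and> successively (\<lambda>u v. {u, v} \<in> E) w \<and> hd w = last w"

definition STAR :: "(nat \<times> nat set set \<times> nat set set, nat list) min_problem" where
  "STAR = \<lparr>
    instances = {(n, E, X). simple_graph n E \<and> X \<subseteq> E \<and> X \<noteq> {}},
    feasible = (\<lambda>(n, E, X). {w. closed_walk n E w \<and> covers (set w) X}),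
    cost = (\<lambda>_ w. length w - 1),
    instance_code = (\<lambda>(n, E, X). vertex_code n @ matrix_code n E @ matrix_code n X),
    solution_codes = (\<lambda>w. {vertices_code w})\<rparr>"

text \<open>A vertex cover may be described by any list of its elements, in any order and
  possibly with repetitions; its cost is the cardinality of the set.\<close>

definition VERTEX_COVER :: "(nat \<times> nat set set, nat set) min_problem" where
  "VERTEX_COVER = \<lparr>
    instances = {(n, E). simple_graph n E},
    feasible = (\<lambda>(n, E). {S. S \<subseteq> {..<n} \<and> covers S E}),
    cost = (\<lambda>_ S. card S),
    instance_code = (\<lambda>(n, E). vertex_code n @ matrix_code n E),
    solution_codes = (\<lambda>S. {vertices_code vs | vs. set vs = S})\<rparr>"

end

theory Submission
  imports Defs
begin

text \<open>
  A graph \<open>(n, E)\<close> with an edge is mapped to the STAR instance consisting of the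
  complete graph on \<open>{..<n}\<close> with \<open>X = E\<close>. A vertex cover of size \<open>k\<close>
  can be arranged into a closed walk of length at most \<open>k\<close>, and conversely a closed walk
  of length \<open>l\<close> visits at most \<open>max 1 l\<close> vertices; since the optimal cover is
  nonempty, the maximum with 1 does no harm. As the code of a walk is also a code of the set of
  its vertices, the output needs no postprocessing. If there are no edges, the empty word is a
  correct output.

  On codes, the reduction inserts the adjacency matrix of the complete graph, which reads
  \<open>0 (1\<^sup>n 0)\<^sup>n\<^sup>-\<^sup>1\<close> row by row, so that the input \<open>1\<^sup>n 0 A\<close> is to be
  replaced by \<open>1\<^sup>n 0 0 (1\<^sup>n 0)\<^sup>n\<^sup>-\<^sup>1 A\<close>. For \<open>n \<ge> 2\<close> the old input is a
  suffix of the new one. A machine with two more tapes, used as counters up to \<open>n\<close>,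
  therefore only has to write on the blank cells to the left of the input, and can then
  run the given machine, whose behaviour is invariant under shifting the input tape.
\<close>

section \<open>Words on tapes\<close>

lemma word_tape_Nil: "word_tape [] = (\<lambda>_. 0)"
  by (simp add: word_tape_def fun_eq_iff)

lemma word_tape_nth: "i < length w \<Longrightarrow> word_tape w (int i) = (if w ! i then 2 else 1)"
  by (simp add: word_tape_def)

lemma word_tape_outside: "i < 0 \<or> int (length w) \<le> i \<Longrightarrow> word_tape w i = 0"
  by (auto simp: word_tape_def)

lemma word_tape_snoc: "(word_tape w)(int (length w) := if b then 2 else 1) = word_tape (w @ [b])"
  by (auto simp: word_tape_def fun_eq_iff nth_append nat_less_iff)

text \<open>The tape whose head scans the blank cell directly to the left of a word.\<close>

definition left_tape :: "int \<Rightarrow> bool list \<Rightarrow> tape" where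
  "left_tape p w = (p, \<lambda>i. word_tape w (i - p - 1))"

lemma left_tape_write:
  "left_tape (p - 1) (b # w) = act (if b then 2 else 1, Go_Left) (left_tape p w)"
  by (auto simp: left_tape_def word_tape_def fun_eq_iff nth_Cons' nat_diff_distrib)

lemma left_tape_blank: "snd (left_tape p w) (fst (left_tape p w)) = 0"
  by (simp add: left_tape_def word_tape_def)

definition shift_tape :: "int \<Rightarrow> tape \<Rightarrow> tape" where
  "shift_tape d t = (fst t + d, \<lambda>i. snd t (i - d))"

definition read :: "tape \<Rightarrow> nat" where
  "read t = snd t (fst t)"

lemma read_shift_tape [simp]: "read (shift_tape d t) = read t"
  by (simp add: read_def shift_tape_def)

text \<open>An action depends only on the scanned cell, and head and contents move together. Hence a
  simulated machine cannot notice that its input begins elsewhere than at cell 0.\<close>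

lemma act_shift_tape: "act a (shift_tape d t) = shift_tape d (act a t)"
proof (cases a; cases t)
  fix x m h f assume "a = (x, m)" "t = (h, f)"
  then show ?thesis
    by (cases m) (auto simp: shift_tape_def fun_eq_iff)
qed

lemma act_read_Stay [simp]: "act (read t, Stay) t = t"
  by (cases t) (simp add: read_def)

lemma write_read [simp]: "f(h := read (h, f)) = f"
  by (simp add: read_def)

lemma map2_act_read_Stay: "map2 act (map (\<lambda>x. (x, Stay)) (map read ts)) ts = ts"
  by (induction ts) simp_all

lemma step_read:
  "step M (q, ts) =
    (if q < tm_states M
     then (fst (tm_trans M q (map read ts)), map2 act (snd (tm_trans M q (map read ts))) ts)
     else (q, ts))"
proof -
  have "(\<lambda>(h, f). f h) = read"
    by (auto simp: read_def fun_eq_iff)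
  then show ?thesis
    by (simp add: case_prod_unfold)
qed


section \<open>Well-formed configurations\<close>

text \<open>\<open>wf_tm\<close> constrains transitions only on tuples of legal symbols of the right
  length, so the simulation needs this invariant; otherwise \<open>map2\<close> might truncate the
  list of tapes.\<close>

definition wf_config :: "tm \<Rightarrow> config \<Rightarrow> bool" where
  "wf_config M c \<longleftrightarrow> length (snd c) = tm_tapes M \<and>
    (\<forall>t \<in> set (snd c). range (snd t) \<subseteq> {..<tm_symbols M})"

lemma wf_config_reads:
  assumes "wf_config M (q, ts)"
  shows "length (map read ts) = tm_tapes M \<and> set (map read ts) \<subseteq> {..<tm_symbols M}"
  using assms by (fastforce simp: wf_config_def read_def)

lemma wf_tm_trans:
  assumes "wf_tm M" "wf_config M (q, ts)" "q < tm_states M"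
  shows "length (snd (tm_trans M q (map read ts))) = tm_tapes M"
    and "fst ` set (snd (tm_trans M q (map read ts))) \<subseteq> {..<tm_symbols M}"
  using assms wf_config_reads[OF assms(2)] unfolding wf_tm_def case_prod_unfold by blast+

lemma wf_config_init: "wf_tm M \<Longrightarrow> wf_config M (init_config M x)"
  by (auto simp: wf_tm_def wf_config_def init_config_def word_tape_def)

lemma wf_config_step:
  assumes "wf_tm M" "wf_config M c"
  shows "wf_config M (step M c)"
proof (cases c)
  case (Pair q ts)
  show ?thesis
  proof (cases "q < tm_states M")
    case True
    define as where "as = snd (tm_trans M q (map read ts))"
    have as: "length as = tm_tapes M" "fst ` set as \<subseteq> {..<tm_symbols M}"
      using wf_tm_trans[of M q ts] assms True unfolding as_def Pair by auto
    have "range (snd (act a t)) \<subseteq> {..<tm_symbols M}" if "(a, t) \<in> set (zip as ts)" for a t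
    proof -
      have "a \<in> set as" "t \<in> set ts"
        using that by (auto dest: set_zip_leftD set_zip_rightD)
      then have "fst a < tm_symbols M" "range (snd t) \<subseteq> {..<tm_symbols M}"
        using as(2) assms(2) by (auto simp: Pair wf_config_def)
      then show ?thesis
        by (cases a; cases t) auto
    qed
    then have "\<forall>t \<in> set (map2 act as ts). range (snd t) \<subseteq> {..<tm_symbols M}"
      unfolding set_map by (metis (mono_tags, lifting) case_prod_unfold image_iff prod.collapse)
    moreover have "length ts = tm_tapes M"
      using assms(2) by (simp add: Pair wf_config_def)
    ultimately show ?thesis
      using True as(1) unfolding Pair step_read wf_config_def as_def by simp
  qed (use assms Pair in simp)
qed

lemma wf_config_run: "wf_tm M \<Longrightarrow> wf_config M (run M x t)"
  unfolding run_def by (induction t) (simp_all add: wf_config_init wf_config_step)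


section \<open>Reachability in bounded time\<close>

text \<open>Only an upper bound on the number of steps is recorded, so that phases compose by adding
  bounds.\<close>

definition reaches :: "tm \<Rightarrow> nat \<Rightarrow> config \<Rightarrow> config \<Rightarrow> bool" where
  "reaches M b c c' \<longleftrightarrow> (\<exists>t \<le> b. (step M ^^ t) c = c')"

lemma reaches_refl: "reaches M b c c"
  unfolding reaches_def by (rule exI[of _ 0]) simp

lemma reaches_trans:
  assumes "reaches M a c c'" "reaches M b c' c''"
  shows "reaches M (a + b) c c''"
proof -
  obtain s t where "s \<le> a" "t \<le> b" "(step M ^^ s) c = c'" "(step M ^^ t) c' = c''"
    using assms unfolding reaches_def by blast
  then have "t + s \<le> a + b \<and> (step M ^^ (t + s)) c = c''"
    by (simp add: funpow_add)
  then show ?thesis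
    unfolding reaches_def by blast
qed

lemma reaches_mono: "reaches M a c c' \<Longrightarrow> a \<le> b \<Longrightarrow> reaches M b c c'"
  unfolding reaches_def by (blast intro: order_trans)

lemma reaches_step: "step M c = c' \<Longrightarrow> reaches M 1 c c'"
  unfolding reaches_def by (rule exI[of _ 1]) simp

lemma reaches_Suc: "reaches M b (step M c) c' \<Longrightarrow> reaches M (Suc b) c c'"
  using reaches_trans[OF reaches_step[OF refl]] by fastforce


section \<open>The reduction machine\<close>

text \<open>
  The arguments are the halting state, the current state, and the symbols read on the input
  tape and on the two additional tapes. State 0 copies the unary prefix \<open>n\<close> to both
  additional tapes, state 1 looks for an edge (halting if there is none), state 2 returns to
  the left end of the input. States 3, 4, 5 extend the input word to the left: each round
  writes \<open>False\<close> followed, from right to left, by \<open>n\<close> times \<open>True\<close>,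
  the rounds being counted on the first and the symbols on the second additional tape.
  Once the first counter is exhausted, its blank is overwritten by 1, an additional
  \<open>False\<close> is written, and one last round leads to state 6, where the given machine
  takes over.
\<close>

definition pre_trans ::
  "nat \<Rightarrow> nat \<Rightarrow> nat \<Rightarrow> nat \<Rightarrow> nat \<Rightarrow> nat \<times> (nat \<times> move) \<times> (nat \<times> move) \<times> (nat \<times> move)" where
  "pre_trans h q x y z =
    (if q = 0 then
       if x = 2 then (0, (2, Go_Right), (2, Go_Right), (2, Go_Right))
       else (1, (x, Go_Right), (y, Go_Left), (z, Go_Left))
     else if q = 1 then
       if x = 1 then (1, (x, Go_Right), (y, Stay), (z, Stay))
       else if x = 2 then (2, (x, Go_Left), (y, Go_Left), (z, Stay))
       else (h, (x, Stay), (y, Stay), (z, Stay))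
     else if q = 2 then
       if x = 0 then (3, (x, Stay), (y, Go_Left), (z, Stay))
       else (2, (x, Go_Left), (y, Stay), (z, Stay))
     else if q = 3 then
       if y = 0 then (3, (1, Go_Left), (1, Stay), (z, Stay))
       else (4, (1, Go_Left), (y, Stay), (z, Stay))
     else if q = 4 then
       if z = 0 then
         if y = 1 then (6, (x, Go_Right), (y, Stay), (z, Stay))
         else (5, (x, Stay), (y, Go_Left), (z, Go_Right))
       else (4, (2, Go_Left), (y, Stay), (z, Go_Left))
     else
       if z = 0 then (3, (x, Stay), (y, Stay), (z, Go_Left))
       else (5, (x, Stay), (y, Stay), (z, Go_Right)))"

text \<open>The counters come after the tapes of \<open>M\<close>, so input and output keep the
  indices 0 and 1. Shifting the states of \<open>M\<close> by 6 sends its halting state to the new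
  one.\<close>

definition reduction_tm :: "tm \<Rightarrow> tm" where
  "reduction_tm M = \<lparr>
    tm_tapes = tm_tapes M + 2,
    tm_symbols = tm_symbols M,
    tm_states = tm_states M + 6,
    tm_trans = (\<lambda>q xs.
      if q < 6 then
        case pre_trans (tm_states M + 6) q (hd xs) (xs ! tm_tapes M) (xs ! Suc (tm_tapes M)) of
          (q', a, b, c) \<Rightarrow>
            (q', a # map (\<lambda>x. (x, Stay)) (take (tm_tapes M - 1) (tl xs)) @ [b, c])
      else
        case tm_trans M (q - 6) (take (tm_tapes M) xs) of
          (q', as) \<Rightarrow> (q' + 6, as @ map (\<lambda>x. (x, Stay)) (drop (tm_tapes M) xs)))\<rparr>"

lemma reduction_tm_sel [simp]:
  "tm_tapes (reduction_tm M) = tm_tapes M + 2"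
  "tm_symbols (reduction_tm M) = tm_symbols M"
  "tm_states (reduction_tm M) = tm_states M + 6"
  by (simp_all add: reduction_tm_def)

lemma pre_trans_wf:
  assumes "pre_trans h q x y z = (q', a, b, c)" "x < s" "y < s" "z < s" "3 \<le> s" "6 \<le> h"
  shows "q' \<le> h \<and> fst a < s \<and> fst b < s \<and> fst c < s"
  using assms unfolding pre_trans_def by (auto split: if_splits)

lemma wf_reduction_tm:
  assumes "wf_tm M"
  shows "wf_tm (reduction_tm M)"
proof -
  let ?k = "tm_tapes M" and ?s = "tm_symbols M"
  have k: "2 \<le> ?k" "3 \<le> ?s"
    using assms by (auto simp: wf_tm_def)
  have *: "q' \<le> tm_states M + 6 \<and> length as = ?k + 2 \<and> fst ` set as \<subseteq> {..<?s}"
    if q: "q < tm_states M + 6" and xs: "length xs = ?k + 2" "set xs \<subseteq> {..<?s}"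
      and trans: "tm_trans (reduction_tm M) q xs = (q', as)" for q xs q' as
  proof (cases "q < 6")
    case True
    obtain r a b c where
      pre: "pre_trans (tm_states M + 6) q (hd xs) (xs ! ?k) (xs ! Suc ?k) = (r, a, b, c)"
      by (metis prod_cases4)
    have as: "q' = r" "as = a # map (\<lambda>x. (x, Stay)) (take (?k - 1) (tl xs)) @ [b, c]"
      using trans True pre by (auto simp: reduction_tm_def)
    have "xs \<noteq> []"
      using xs by auto
    then have "hd xs < ?s" "xs ! ?k < ?s" "xs ! Suc ?k < ?s"
      using xs by (auto simp: subset_iff)
    from pre_trans_wf[OF pre this k(2)]
    have "r \<le> tm_states M + 6 \<and> fst a < ?s \<and> fst b < ?s \<and> fst c < ?s"
      by simp
    moreover have "set (take (?k - 1) (tl xs)) \<subseteq> {..<?s}"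
      using xs(2) \<open>xs \<noteq> []\<close> by (meson order_trans set_take_subset list.set_sel(2) subset_iff)
    ultimately show ?thesis
      using k xs(1) unfolding as by (auto simp: image_image)
  next
    case False
    obtain r bs where M: "tm_trans M (q - 6) (take ?k xs) = (r, bs)"
      by (metis surj_pair)
    have as: "q' = r + 6" "as = bs @ map (\<lambda>x. (x, Stay)) (drop ?k xs)"
      using trans False M by (auto simp: reduction_tm_def)
    have "q - 6 < tm_states M" "length (take ?k xs) = ?k" "set (take ?k xs) \<subseteq> {..<?s}"
      using q False xs by (auto dest: in_set_takeD)
    then have "r \<le> tm_states M \<and> length bs = ?k \<and> fst ` set bs \<subseteq> {..<?s}"
      using assms M unfolding wf_tm_def by fastforce
    moreover have "set (drop ?k xs) \<subseteq> {..<?s}"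
      using xs(2) by (meson order_trans set_drop_subset)
    ultimately show ?thesis
      using xs(1) unfolding as by (auto simp: image_image)
  qed
  have "case tm_trans (reduction_tm M) q xs of (q', as) \<Rightarrow>
      q' \<le> tm_states M + 6 \<and> length as = ?k + 2 \<and> fst ` set as \<subseteq> {..<?s}"
    if "q < tm_states M + 6" "length xs = ?k + 2" "set xs \<subseteq> {..<?s}" for q xs
    using *[OF that prod.collapse[symmetric]] by (simp only: split_def)
  then show ?thesis
    using k unfolding wf_tm_def reduction_tm_sel by simp
qed


section \<open>Simulation of the given machine\<close>

text \<open>The offset \<open>d\<close> and the counter tapes \<open>u\<close>, \<open>v\<close> are
  arbitrary, since the simulated machine does not depend on how preprocessing left them.\<close>

definition embed_config :: "int \<Rightarrow> tape \<Rightarrow> tape \<Rightarrow> config \<Rightarrow> config" where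
  "embed_config d u v c = (fst c + 6, shift_tape d (hd (snd c)) # tl (snd c) @ [u, v])"

lemma step_embed_config:
  assumes "wf_tm M" "wf_config M c"
  shows "step (reduction_tm M) (embed_config d u v c) = embed_config d u v (step M c)"
proof -
  obtain q t ts where c: "c = (q, t # ts)"
    using assms by (cases c; cases "snd c") (auto simp: wf_config_def wf_tm_def)
  have k: "length (t # ts) = tm_tapes M"
    using assms(2) by (simp add: wf_config_def c)
  show ?thesis
  proof (cases "q < tm_states M")
    case True
    define as where "as = snd (tm_trans M q (map read (t # ts)))"
    define q' where "q' = fst (tm_trans M q (map read (t # ts)))"
    \<comment> \<open>Equal lengths make the two appended actions fall exactly on \<open>u\<close>
      and \<open>v\<close>.\<close>
    have "length as = length (t # ts)"
      unfolding as_def k using wf_tm_trans(1)[of M q "t # ts"] assms True c by auto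
    then obtain a bs where as: "as = a # bs" "length bs = length ts"
      by (cases as) auto
    have reads: "map read (shift_tape d t # ts @ [u, v]) = map read (t # ts) @ [read u, read v]"
      by simp
    have "tm_trans (reduction_tm M) (q + 6) (map read (t # ts) @ [read u, read v])
        = (q' + 6, as @ [(read u, Stay), (read v, Stay)])"
      using k unfolding reduction_tm_def as_def q'_def by (simp add: case_prod_unfold flip: k)
    then have "step (reduction_tm M) (embed_config d u v c)
        = (q' + 6, map2 act (as @ [(read u, Stay), (read v, Stay)]) (shift_tape d t # ts @ [u, v]))"
      using True unfolding c embed_config_def step_read fst_conv snd_conv list.sel reads by simp
    moreover have "step M c = (q', map2 act as (t # ts))"
      using True unfolding c step_read as_def q'_def by simp
    ultimately show ?thesis
      using as by (simp add: embed_config_def act_shift_tape)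
  qed (simp add: c embed_config_def)
qed

lemma steps_embed_config:
  assumes "wf_tm M"
  shows "(step (reduction_tm M) ^^ t) (embed_config d u v (init_config M x))
    = embed_config d u v (run M x t)"
proof (induction t)
  case (Suc t)
  then show ?case
    using step_embed_config[OF assms wf_config_run[OF assms]] by (simp add: run_def)
qed (simp add: run_def)


section \<open>The preprocessing phase\<close>

text \<open>Preprocessing keeps the tapes of \<open>M\<close> other than the input blank with head
  at 0, so afterwards they are as in an initial configuration.\<close>

definition pre_config :: "tm \<Rightarrow> nat \<Rightarrow> tape \<Rightarrow> tape \<Rightarrow> tape \<Rightarrow> config" where
  "pre_config M q t u v = (q, t # replicate (tm_tapes M - 1) (0, \<lambda>_. 0) @ [u, v])"

lemma step_pre_config:
  assumes "wf_tm M" "q < 6"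
    and "pre_trans (tm_states M + 6) q (read t) (read u) (read v) = (q', a, b, c)"
  shows "step (reduction_tm M) (pre_config M q t u v)
    = pre_config M q' (act a t) (act b u) (act c v)"
proof -
  define mid :: "tape list" where "mid = replicate (tm_tapes M - 1) (0, \<lambda>_. 0)"
  have k: "tm_tapes M = Suc (length mid)"
    using assms(1) by (auto simp: wf_tm_def mid_def)
  have reads: "map read (t # mid @ [u, v]) = read t # map read mid @ [read u, read v]"
    by simp
  have "tm_trans (reduction_tm M) q (map read (t # mid @ [u, v]))
    = (q', a # map (\<lambda>x. (x, Stay)) (map read mid) @ [b, c])"
    unfolding reads using assms(2,3) k by (simp add: reduction_tm_def nth_append)
  then show ?thesis
    using assms(2) map2_act_read_Stay[of mid]
    unfolding pre_config_def step_read mid_def[symmetric] by simp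
qed

lemma init_reduction_tm:
  assumes "wf_tm M"
  shows "init_config (reduction_tm M) x
    = pre_config M 0 (0, word_tape x) (0, word_tape []) (0, word_tape [])"
proof -
  obtain k where "tm_tapes M = Suc k"
    using assms by (cases "tm_tapes M") (auto simp: wf_tm_def)
  then show ?thesis
    by (simp add: init_config_def pre_config_def word_tape_Nil
        flip: replicate_append_same)
qed

text \<open>The head scans the blank before \<open>w\<close>; rewriting it and moving right reaches
  cell \<open>p + 1\<close>, where \<open>w\<close> starts, and this becomes the offset.\<close>

lemma embed_init_config:
  "embed_config (p + 1) u v (init_config M w)
    = pre_config M 6 (act (0, Go_Right) (left_tape p w)) u v"
  by (auto simp: embed_config_def init_config_def pre_config_def shift_tape_def left_tape_def
      word_tape_def fun_eq_iff algebra_simps)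

context
  fixes M :: tm
  assumes wf: "wf_tm M"
begin

abbreviation (input) R where "R \<equiv> reduction_tm M"
abbreviation (input) cfg where "cfg \<equiv> pre_config M"
abbreviation (input) ones where "ones n \<equiv> replicate n True"

lemmas pre_step = step_pre_config[OF wf]

section \<open>Loops of the individual states\<close>

lemma copy_prefix:
  assumes "\<And>j. j < m \<Longrightarrow> f (int (i + j)) = 2"
  shows "reaches R m
    (cfg 0 (int i, f) (int i, word_tape (ones i)) (int i, word_tape (ones i)))
    (cfg 0 (int (i + m), f) (int (i + m), word_tape (ones (i + m)))
       (int (i + m), word_tape (ones (i + m))))"
  using assms
proof (induction m arbitrary: i)
  case (Suc m)
  have f: "f (int i) = 2"
    using Suc.prems[of 0] by simp
  then have upd: "f(int i := 2) = f"
    by auto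
  have ruler: "(word_tape (ones i))(int i := 2) = word_tape (ones (Suc i))"
    using word_tape_snoc[of "ones i" True] by (simp add: replicate_append_same)
  have "step R (cfg 0 (int i, f) (int i, word_tape (ones i)) (int i, word_tape (ones i)))
    = cfg 0 (int (Suc i), f) (int (Suc i), word_tape (ones (Suc i)))
        (int (Suc i), word_tape (ones (Suc i)))"
    by (subst pre_step) (auto simp: pre_trans_def read_def f upd ruler add.commute simp del: replicate_Suc)
  moreover have "reaches R m
      (cfg 0 (int (Suc i), f) (int (Suc i), word_tape (ones (Suc i)))
        (int (Suc i), word_tape (ones (Suc i))))
      (cfg 0 (int (Suc i + m), f) (int (Suc i + m), word_tape (ones (Suc i + m)))
        (int (Suc i + m), word_tape (ones (Suc i + m))))"
    using Suc.prems[of "Suc _"] by (intro Suc.IH) simp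
  ultimately show ?case
    by (intro reaches_Suc) (simp del: replicate_Suc)
qed (simp add: reaches_refl)

lemma skip_nonedges:
  assumes "\<And>j. j < m \<Longrightarrow> f (i + int j) = 1"
  shows "reaches R m (cfg 1 (i, f) u v) (cfg 1 (i + int m, f) u v)"
  using assms
proof (induction m arbitrary: i)
  case (Suc m)
  have "f i = 1"
    using Suc.prems[of 0] by simp
  then have f: "read (i, f) = 1" "f(i := Suc 0) = f"
    by (auto simp: read_def)
  then have "step R (cfg 1 (i, f) u v) = cfg 1 (i + 1, f) u v"
    by (subst pre_step) (auto simp: pre_trans_def f)
  moreover have "reaches R m (cfg 1 (i + 1, f) u v) (cfg 1 (i + 1 + int m, f) u v)"
    using Suc.prems[of "Suc _"] by (intro Suc.IH) (simp add: algebra_simps)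
  ultimately show ?case
    by (intro reaches_Suc) (simp add: algebra_simps)
qed (simp add: reaches_refl)

lemma return_left:
  assumes "\<And>j. j < m \<Longrightarrow> f (i - int j) \<noteq> 0"
  shows "reaches R m (cfg 2 (i, f) u v) (cfg 2 (i - int m, f) u v)"
  using assms
proof (induction m arbitrary: i)
  case (Suc m)
  have "f i \<noteq> 0"
    using Suc.prems[of 0] by simp
  then have "step R (cfg 2 (i, f) u v) = cfg 2 (i - 1, f) u v"
    by (subst pre_step) (auto simp: pre_trans_def read_def[of "(i, f)"])
  moreover have "reaches R m (cfg 2 (i - 1, f) u v) (cfg 2 (i - 1 - int m, f) u v)"
    using Suc.prems[of "Suc _"] by (intro Suc.IH) (simp add: algebra_simps)
  ultimately show ?case
    by (intro reaches_Suc) (simp add: algebra_simps)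
qed (simp add: reaches_refl)

text \<open>A counter head on cell \<open>m - 1\<close> still has \<open>m\<close> marks to pass,
  each worth one \<open>True\<close>; the blank at cell -1 ends the loop.\<close>

lemma write_ones:
  assumes "m \<le> n"
  shows "reaches R m
    (cfg 4 (left_tape p w) u (int m - 1, word_tape (ones n)))
    (cfg 4 (left_tape (p - int m) (ones m @ w)) u (- 1, word_tape (ones n)))"
  using assms
proof (induction m arbitrary: p w)
  case (Suc m)
  let ?v = "(int m, word_tape (ones n))"
  have v: "read ?v = 2"
    using Suc.prems by (simp add: read_def word_tape_nth)
  then have "(word_tape (ones n))(int m := 2) = word_tape (ones n)"
    by (auto simp: read_def)
  then have "step R (cfg 4 (left_tape p w) u ?v)
    = cfg 4 (left_tape (p - 1) (True # w)) u (int m - 1, word_tape (ones n))"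
    by (subst pre_step)
      (auto simp: pre_trans_def v left_tape_write simp del: act.simps, simp)
  moreover have "reaches R m
    (cfg 4 (left_tape (p - 1) (True # w)) u (int m - 1, word_tape (ones n)))
    (cfg 4 (left_tape (p - 1 - int m) (ones m @ True # w)) u (- 1, word_tape (ones n)))"
    using Suc by simp
  ultimately show ?case
    by (intro reaches_Suc) (simp add: algebra_simps replicate_app_Cons_same)
qed (simp add: reaches_refl)

lemma rewind_ruler:
  assumes "m \<le> n"
  shows "reaches R m
    (cfg 5 t u (int (n - m), word_tape (ones n))) (cfg 5 t u (int n, word_tape (ones n)))"
  using assms
proof (induction m)
  case (Suc m)
  let ?v = "(int (n - Suc m), word_tape (ones n))"
  have v: "read ?v = 2"
    using Suc.prems by (simp add: read_def word_tape_nth del: of_nat_diff)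
  then have "(word_tape (ones n))(int (n - Suc m) := 2) = word_tape (ones n)"
    by (auto simp: read_def simp del: of_nat_diff)
  moreover have "int (n - Suc m) + 1 = int (n - m)"
    using Suc.prems by simp
  ultimately have "step R (cfg 5 t u ?v) = cfg 5 t u (int (n - m), word_tape (ones n))"
    by (subst pre_step) (auto simp: pre_trans_def v simp del: of_nat_diff)
  then show ?case
    using Suc by (intro reaches_Suc) simp
qed (simp add: reaches_refl)

text \<open>State 3 starts a block on any nonblank symbol of \<open>u\<close>; this covers both the
  marks 2 of ordinary rounds and the 1 that announces the last one.\<close>

lemma write_block:
  assumes "read u \<noteq> 0"
  shows "reaches R (Suc n)
    (cfg 3 (left_tape p w) u (int n - 1, word_tape (ones n)))
    (cfg 4 (left_tape (p - 1 - int n) (ones n @ False # w)) u (- 1, word_tape (ones n)))"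
proof (rule reaches_Suc)
  have "step R (cfg 3 (left_tape p w) u (int n - 1, word_tape (ones n)))
    = cfg 4 (left_tape (p - 1) (False # w)) u (int n - 1, word_tape (ones n))"
    using assms
    by (subst pre_step)
      (auto simp: pre_trans_def left_tape_write simp del: act.simps)
  then show "reaches R n
    (step R (cfg 3 (left_tape p w) u (int n - 1, word_tape (ones n))))
    (cfg 4 (left_tape (p - 1 - int n) (ones n @ False # w)) u (- 1, word_tape (ones n)))"
    using write_ones[of n n "p - 1" "False # w" u] by simp
qed

text \<open>The block takes \<open>n + 1\<close> steps, rewinding the second counter
  \<open>n\<close>, and the passages from state 4 to 5 and from 5 to 3 one each.\<close>

lemma write_round:
  assumes "j < n"
  shows "reaches R (2 * n + 3)
    (cfg 3 (left_tape p w) (int j, word_tape (ones n)) (int n - 1, word_tape (ones n)))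
    (cfg 3 (left_tape (p - 1 - int n) (ones n @ False # w)) (int j - 1, word_tape (ones n))
       (int n - 1, word_tape (ones n)))"
proof -
  let ?f = "word_tape (ones n)"
  let ?t = "left_tape (p - 1 - int n) (ones n @ False # w)"
  \<comment> \<open>Reading 2 rather than 1 keeps state 4 from handing over to
    \<open>M\<close>.\<close>
  have u: "read (int j, ?f) = 2"
    using assms by (simp add: read_def word_tape_nth)
  have v: "read (- 1, ?f) = 0" "read (int n, ?f) = 0"
    by (simp_all add: read_def word_tape_outside)
  have upd: "?f(int j := 2) = ?f" "?f(- 1 := 0) = ?f" "?f(int n := 0) = ?f"
    using u v by (auto simp: read_def)
  have 1: "reaches R (Suc n) (cfg 3 (left_tape p w) (int j, ?f) (int n - 1, ?f))
      (cfg 4 ?t (int j, ?f) (- 1, ?f))"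
    using u by (intro write_block) simp
  have 2: "step R (cfg 4 ?t (int j, ?f) (- 1, ?f)) = cfg 5 ?t (int j - 1, ?f) (0, ?f)"
    by (subst pre_step) (auto simp: pre_trans_def u v upd)
  have 3: "reaches R n (cfg 5 ?t (int j - 1, ?f) (0, ?f)) (cfg 5 ?t (int j - 1, ?f) (int n, ?f))"
    using rewind_ruler[of n n] by simp
  have 4: "step R (cfg 5 ?t (int j - 1, ?f) (int n, ?f)) = cfg 3 ?t (int j - 1, ?f) (int n - 1, ?f)"
    by (subst pre_step) (auto simp: pre_trans_def v upd)
  show ?thesis
    using reaches_trans[OF reaches_trans[OF reaches_trans[OF 1 reaches_step[OF 2]] 3]
        reaches_step[OF 4]]
    by (rule reaches_mono) simp
qed

abbreviation (input) blocks where "blocks n m \<equiv> concat (replicate m (ones n @ [False]))"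

text \<open>Each round moves the first counter one cell left, so a start at \<open>j - 1\<close>
  gives \<open>j\<close> rounds before the blank. The final head position may stay existential
  because the simulation works at every offset.\<close>

lemma write_rounds:
  assumes "j \<le> n"
  shows "\<exists>p'. reaches R (j * (2 * n + 3))
    (cfg 3 (left_tape p w) (int j - 1, word_tape (ones n)) (int n - 1, word_tape (ones n)))
    (cfg 3 (left_tape p' (blocks n j @ w)) (- 1, word_tape (ones n))
       (int n - 1, word_tape (ones n)))"
  using assms
proof (induction j arbitrary: p w)
  case 0
  then show ?case
    by (auto intro: reaches_refl)
next
  case (Suc j)
  let ?f = "word_tape (ones n)"
  \<comment> \<open>The block written first ends up rightmost; all blocks being equal, it merges
    into the repetition.\<close>
  have w: "blocks n j @ ones n @ False # w = blocks n (Suc j) @ w"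
    by (induction j) simp_all
  obtain p' where "reaches R (j * (2 * n + 3))
    (cfg 3 (left_tape (p - 1 - int n) (ones n @ False # w)) (int j - 1, ?f) (int n - 1, ?f))
    (cfg 3 (left_tape p' (blocks n (Suc j) @ w)) (- 1, ?f) (int n - 1, ?f))"
    using Suc.IH[of "p - 1 - int n" "ones n @ False # w"] Suc.prems unfolding w by auto
  from reaches_trans[OF write_round this] show ?case
    using Suc.prems by auto
qed

text \<open>The first \<open>False\<close> written is the diagonal entry in row 0, the second ends
  the unary prefix. The mark 1 put on the first counter makes state 4 hand over to \<open>M\<close>
  after this block.\<close>

lemma write_last_round:
  "\<exists>p' u v. reaches R (n + 3)
    (cfg 3 (left_tape p w) (- 1, word_tape (ones n)) (int n - 1, word_tape (ones n)))
    (embed_config p' u v (init_config M (ones n @ False # False # w)))"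
proof -
  let ?f = "word_tape (ones n)"
  let ?u = "(- 1, ?f(- 1 := 1))"
  let ?w = "ones n @ False # False # w"
  let ?p = "p - 1 - 1 - int n"
  have u: "read ?u = 1" "read (- 1, ?f) = 0"
    by (simp_all add: read_def word_tape_outside)
  have 1: "step R (cfg 3 (left_tape p w) (- 1, ?f) (int n - 1, ?f))
    = cfg 3 (left_tape (p - 1) (False # w)) ?u (int n - 1, ?f)"
    by (subst pre_step)
      (auto simp: pre_trans_def u left_tape_write simp del: act.simps, simp)
  have 2: "reaches R (Suc n) (cfg 3 (left_tape (p - 1) (False # w)) ?u (int n - 1, ?f))
      (cfg 4 (left_tape ?p ?w) ?u (- 1, ?f))"
    using u by (intro write_block) simp
  have 3: "step R (cfg 4 (left_tape ?p ?w) ?u (- 1, ?f))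
    = embed_config (?p + 1) ?u (- 1, ?f) (init_config M ?w)"
    unfolding embed_init_config
    using act_read_Stay[of ?u] act_read_Stay[of "(- 1, ?f)"] left_tape_blank[of ?p ?w] u
    by (subst pre_step) (auto simp: pre_trans_def read_def[of "left_tape _ _"])
  show ?thesis
    using reaches_trans[OF reaches_trans[OF reaches_step[OF 1] 2] reaches_step[OF 3]]
    by (intro exI, rule reaches_mono) simp_all
qed

section \<open>The two branches of the preprocessing\<close>

lemma enter_edge_search:
  "reaches R (n + 1) (init_config R (vertex_code n @ A))
    (cfg 1 (int n + 1, word_tape (vertex_code n @ A)) (int n - 1, word_tape (ones n))
       (int n - 1, word_tape (ones n)))"
proof -
  let ?f = "word_tape (vertex_code n @ A)" and ?r = "word_tape (ones n)"
  have 1: "reaches R n (cfg 0 (0, ?f) (0, word_tape []) (0, word_tape []))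
    (cfg 0 (int n, ?f) (int n, ?r) (int n, ?r))"
    using copy_prefix[of n ?f 0] by (simp add: word_tape_nth vertex_code_def nth_append)
  have f: "read (int n, ?f) = 1"
    by (simp add: read_def word_tape_nth vertex_code_def nth_append)
  have r: "read (int n, ?r) = 0"
    by (simp add: read_def word_tape_outside)
  have upd: "?f(int n := Suc 0) = ?f" "?r(int n := 0) = ?r"
    using f r by (auto simp: read_def)
  have 2: "step R (cfg 0 (int n, ?f) (int n, ?r) (int n, ?r))
    = cfg 1 (int n + 1, ?f) (int n - 1, ?r) (int n - 1, ?r)"
    by (subst pre_step) (auto simp: pre_trans_def f r upd)
  show ?thesis
    using reaches_trans[OF 1 reaches_step[OF 2]] init_reduction_tm[OF wf] by simp
qed

lemma no_edge_halts:
  assumes "True \<notin> set A"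
  shows "\<exists>c. reaches R (n + length A + 2) (init_config R (vertex_code n @ A)) c \<and>
    halted R c \<and> has_output c []"
proof -
  let ?x = "vertex_code n @ A"
  let ?f = "word_tape ?x" and ?u = "(int n - 1, word_tape (ones n))"
  have "?f (int n + 1 + int j) = 1" if "j < length A" for j
    using that assms word_tape_nth[of "n + 1 + j" ?x]
    by (auto simp: vertex_code_def nth_append add_ac dest: nth_mem)
  then have 1: "reaches R (length A) (cfg 1 (int n + 1, ?f) ?u ?u)
      (cfg 1 (int n + 1 + int (length A), ?f) ?u ?u)"
    by (intro skip_nonedges) auto
  let ?t = "(int n + 1 + int (length A), ?f)"
  have "read ?t = 0"
    by (simp add: read_def word_tape_outside vertex_code_def)
  then have 2: "step R (cfg 1 ?t ?u ?u) = cfg (tm_states M + 6) ?t ?u ?u"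
    using act_read_Stay[of ?t]
    by (subst pre_step) (auto simp: pre_trans_def simp del: act.simps)
  \<comment> \<open>Tape 1 is one of the untouched blank tapes, so the output is the empty
    word.\<close>
  have "2 \<le> tm_tapes M"
    using wf by (simp add: wf_tm_def)
  then have "has_output (cfg (tm_states M + 6) ?t ?u ?u) []"
    by (simp add: has_output_def pre_config_def word_tape_Nil nth_append)
  moreover have "halted R (cfg (tm_states M + 6) ?t ?u ?u)"
    by (simp add: halted_def pre_config_def)
  moreover have "reaches R (n + length A + 2) (init_config R ?x)
      (cfg (tm_states M + 6) ?t ?u ?u)"
    using reaches_trans[OF reaches_trans[OF enter_edge_search 1] reaches_step[OF 2]]
    by (rule reaches_mono) simp
  ultimately show ?thesis
    by blast
qed

lemma edge_simulates:
  assumes "True \<in> set A" "2 \<le> n"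
  shows "\<exists>d u v. reaches R (3 * n + 2 * length A + 6 + n * (2 * n + 3))
    (init_config R (vertex_code n @ A))
    (embed_config d u v
      (init_config M (vertex_code n @ False # blocks n (n - 1) @ A)))"
proof -
  let ?x = "vertex_code n @ A"
  let ?f = "word_tape ?x" and ?r = "word_tape (ones n)"
  let ?v = "(int n - 1, ?r)"
  obtain B C where A: "A = B @ True # C" "True \<notin> set B"
    using split_list_first[OF assms(1)] by blast
  let ?m = "length B"
  have "?f (int n + 1 + int j) = 1" if "j < ?m" for j
    using that A word_tape_nth[of "n + 1 + j" ?x]
    by (auto simp: vertex_code_def nth_append add_ac dest: nth_mem)
  then have 1: "reaches R ?m (cfg 1 (int n + 1, ?f) ?v ?v)
      (cfg 1 (int n + 1 + int ?m, ?f) ?v ?v)"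
    by (intro skip_nonedges) auto
  have f: "?f (int n + 1 + int ?m) = 2"
    using word_tape_nth[of "n + 1 + ?m" ?x] A
    by (auto simp: vertex_code_def nth_append add_ac)
  have r: "?r (int n - 1) = 2" "?r (int n - 2) = 2"
    using assms(2) word_tape_nth[of "n - 1" "ones n"] word_tape_nth[of "n - 2" "ones n"]
    by (simp_all add: of_nat_diff)
  have upd: "?f(int n + 1 + int ?m := 2) = ?f" "?r(int n - 1 := 2) = ?r"
    "?r(int n - 2 := 2) = ?r" "?f(- 1 := 0) = ?f"
    using f r by (auto simp: word_tape_outside)
  \<comment> \<open>Finding an edge moves the first counter from cell \<open>n - 1\<close> to
    \<open>n - 2\<close>, and reaching the left end will move it to \<open>n - 3\<close>. This
    leaves \<open>n - 2\<close> ordinary rounds.\<close>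
  have 2: "step R (cfg 1 (int n + 1 + int ?m, ?f) ?v ?v)
      = cfg 2 (int n + int ?m, ?f) (int n - 2, ?r) ?v"
    by (subst pre_step) (auto simp: pre_trans_def read_def f r upd)
  \<comment> \<open>Cells \<open>n + ?m\<close> down to 0 all lie in the word, so
    \<open>n + ?m + 1\<close> left moves end on the blank at cell -1.\<close>
  have "?f (int n + int ?m - int j) \<noteq> 0" if "j < Suc (n + ?m)" for j
    using that by (auto simp: word_tape_def vertex_code_def A)
  then have 3: "reaches R (Suc (n + ?m)) (cfg 2 (int n + int ?m, ?f) (int n - 2, ?r) ?v)
      (cfg 2 (int n + int ?m - int (Suc (n + ?m)), ?f) (int n - 2, ?r) ?v)"
    by (intro return_left) auto
  have 4: "step R (cfg 2 (int n + int ?m - int (Suc (n + ?m)), ?f) (int n - 2, ?r) ?v)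
      = cfg 3 (left_tape (- 1) ?x) (int (n - 2) - 1, ?r) ?v"
    using assms(2)
    by (subst pre_step) (auto simp: pre_trans_def read_def r upd left_tape_def word_tape_outside)
  obtain p where 5: "reaches R ((n - 2) * (2 * n + 3))
      (cfg 3 (left_tape (- 1) ?x) (int (n - 2) - 1, ?r) ?v)
      (cfg 3 (left_tape p (blocks n (n - 2) @ ?x)) (- 1, ?r) ?v)"
    using write_rounds[of "n - 2" n] by auto
  obtain d u v where 6: "reaches R (n + 3) (cfg 3 (left_tape p (blocks n (n - 2) @ ?x)) (- 1, ?r) ?v)
      (embed_config d u v (init_config M (ones n @ False # False # blocks n (n - 2) @ ?x)))"
    using write_last_round by blast
  obtain m where n: "n = Suc (Suc m)"
    using assms(2) by (cases n; cases "n - 1") auto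
  have blocks: "blocks n m @ ones n @ [False] = blocks n (Suc m)" for n m
    by (induction m) simp_all
  \<comment> \<open>The unary prefix of the old input serves as the last of the \<open>n - 1\<close>
    blocks, so writing \<open>n - 2\<close> of them suffices.\<close>
  have word: "ones n @ False # False # blocks n (n - 2) @ ?x
      = vertex_code n @ False # blocks n (n - 1) @ A"
    using blocks[of m n] by (simp add: vertex_code_def n del: replicate_Suc)
  have time: "n + 1 + ?m + 1 + Suc (n + ?m) + 1 + (n - 2) * (2 * n + 3) + (n + 3)
      \<le> 3 * n + 2 * length A + 6 + n * (2 * n + 3)"
  proof -
    have "(n - 2) * (2 * n + 3) \<le> n * (2 * n + 3)"
      by (intro mult_le_mono1) simp
    moreover have "length A = ?m + 1 + length C"
      by (simp add: A)
    ultimately show ?thesis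
      by linarith
  qed
  show ?thesis
    using reaches_mono[OF reaches_trans[OF reaches_trans[OF reaches_trans[OF reaches_trans[OF
      reaches_trans[OF reaches_trans[OF enter_edge_search 1] reaches_step[OF 2]] 3] reaches_step[OF 4]] 5] 6]
      time]
    unfolding word by blast
qed

end


section \<open>The reduction\<close>

definition complete_graph :: "nat \<Rightarrow> nat set set" where
  "complete_graph n = {{i, j} | i j. i < n \<and> j < n \<and> i \<noteq> j}"

lemma simple_graph_complete: "simple_graph n (complete_graph n)"
  by (auto simp: simple_graph_def complete_graph_def)

lemma simple_graph_subset_complete: "simple_graph n E \<Longrightarrow> E \<subseteq> complete_graph n"
  by (fastforce simp: simple_graph_def complete_graph_def card_2_iff)

lemma complete_graph_edge: "{i, j} \<in> complete_graph n \<longleftrightarrow> i < n \<and> j < n \<and> i \<noteq> j"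
  by (auto simp: complete_graph_def doubleton_eq_iff)

lemma length_matrix_code: "length (matrix_code n E) = n * n"
  by (simp add: matrix_code_def length_concat o_def sum_list_triv)

lemma matrix_code_edge:
  assumes "simple_graph n E"
  shows "True \<in> set (matrix_code n E) \<longleftrightarrow> E \<noteq> {}"
proof -
  have "True \<in> set (matrix_code n E) \<longleftrightarrow> (\<exists>i\<in>{0..<n}. \<exists>j\<in>{0..<n}. {i, j} \<in> E)"
    by (simp add: matrix_code_def image_iff)
  also have "\<dots> \<longleftrightarrow> E \<noteq> {}"
    using assms by (fastforce simp: simple_graph_def card_2_iff)
  finally show ?thesis .
qed

text \<open>Between consecutive diagonal zeros lie \<open>n\<close> ones: \<open>n - 1 - i\<close>
  ending row \<open>i\<close> and \<open>i + 1\<close> starting the next. The \<open>m\<close>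
  appended ones are what row \<open>m\<close> would begin with; they complete the last
  group.\<close>

lemma matrix_code_complete_rows:
  assumes "m \<le> n"
  shows "concat (map (\<lambda>i. map (\<lambda>j. {i, j} \<in> complete_graph n) [0..<n]) [0..<m]) @ replicate m True
    = concat (replicate m (False # replicate n True))"
  using assms
proof (induction m)
  case (Suc m)
  let ?row = "\<lambda>i. map (\<lambda>j. {i, j} \<in> complete_graph n) [0..<n]"
  \<comment> \<open>The first \<open>m\<close> ones on the right complete the group left open by the
    earlier rows, as the induction hypothesis requires.\<close>
  have row: "?row m @ replicate (Suc m) True = replicate m True @ False # replicate n True"
    using Suc.prems
    by (intro nth_equalityI)
      (auto simp: nth_append nth_Cons' complete_graph_edge simp del: replicate_Suc)
  have "concat (map ?row [0..<Suc m]) @ replicate (Suc m) True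
      = concat (map ?row [0..<m]) @ ?row m @ replicate (Suc m) True"
    by simp
  also have "\<dots> = concat (replicate m (False # replicate n True)) @ False # replicate n True"
    unfolding row using Suc by simp
  also have "\<dots> = concat (replicate (Suc m) (False # replicate n True))"
    by (induction m) simp_all
  finally show ?case .
qed simp

lemma matrix_code_complete:
  assumes "0 < n"
  shows "matrix_code n (complete_graph n)
    = False # concat (replicate (n - 1) (replicate n True @ [False]))"
proof -
  obtain k where n: "n = Suc k"
    using assms by (cases n) auto
  \<comment> \<open>Regrouping from zero-first to zero-last leaves a trailing \<open>xs\<close>,
    which cancels against the appended ones.\<close>
  have "concat (replicate (Suc k) (False # xs))
      = False # concat (replicate k (xs @ [False])) @ xs" for k xs
    by (induction k) simp_all
  from this[of k "replicate n True"] show ?thesis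
    using matrix_code_complete_rows[of n n] n
    unfolding matrix_code_def by (simp del: replicate_Suc upt_Suc)
qed

section \<open>Optimal values, closed walks and covers\<close>

lemma optimum_le:
  assumes "S \<in> feasible P I"
  shows "optimum P I \<le> cost P I S"
  unfolding optimum_def using assms by (intro cInf_lower) auto

lemma optimum_attained:
  assumes "feasible P I \<noteq> {}"
  obtains S where "S \<in> feasible P I" "cost P I S = optimum P I"
  using assms Inf_nat_def1[of "cost P I ` feasible P I"] unfolding optimum_def by force

text \<open>An enumeration of \<open>S\<close> without repetition, closed up, has
  \<open>card S\<close> edges. A singleton would need a loop to close up; there the walk of length 0
  serves, whence only an inequality.\<close>

lemma closed_walk_complete:
  assumes "S \<subseteq> {..<n}" "S \<noteq> {}"
  obtains w where "closed_walk n (complete_graph n) w" "set w = S" "length w - 1 \<le> card S"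
proof -
  have "finite S"
    using assms(1) finite_subset by blast
  then obtain xs where xs: "set xs = S" "distinct xs"
    using finite_distinct_list by blast
  then obtain y ys where ys: "xs = y # ys"
    using assms(2) by (cases xs) auto
  have card: "card S = length xs"
    using xs distinct_card by fastforce
  show thesis
  proof (cases "ys = []")
    case True
    then show ?thesis
      using xs ys assms by (intro that[of "[y]"]) (auto simp: closed_walk_def)
  next
    case False
    let ?E = "\<lambda>i j. {i, j} \<in> complete_graph n"
    have "successively ?E xs"
      if "distinct xs" "set xs \<subseteq> {..<n}" for xs
      using that by (induction xs rule: induct_list012) (auto simp: complete_graph_edge)
    then have "successively ?E xs"
      using xs assms by auto
    moreover have "last xs \<noteq> y" "last xs < n" "y < n"
      using False xs assms(1) ys last_in_set[of ys] by (auto simp: subset_iff)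
    moreover have "hd (xs @ [y]) = y" "xs \<noteq> []"
      by (simp_all add: ys)
    moreover have "set xs \<subseteq> {..<n}"
      using xs(1) assms(1) by simp
    ultimately have "closed_walk n (complete_graph n) (xs @ [y])"
      by (simp add: closed_walk_def successively_append_iff complete_graph_edge)
    then show ?thesis
      using card xs ys by (intro that[of "xs @ [y]"]) auto
  qed
qed

text \<open>The first vertex recurs at the end, so dropping it loses none. The 1 accounts for walks
  of length 0.\<close>

lemma card_closed_walk:
  assumes "closed_walk n E w"
  shows "card (set w) \<le> max 1 (length w - 1)"
proof (cases w)
  case (Cons x xs)
  show ?thesis
  proof (cases "xs = []")
    case False
    then have "set w = set xs"
      using assms Cons last_in_set[of xs] by (auto simp: closed_walk_def)
    then show ?thesis
      using card_length[of xs] Cons by simp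
  qed (use Cons in simp)
qed simp

lemma feasible_VERTEX_COVER:
  "feasible VERTEX_COVER (n, E) = {S. S \<subseteq> {..<n} \<and> covers S E}"
  by (simp add: VERTEX_COVER_def)

lemma feasible_STAR:
  "feasible STAR (n, E, X) = {w. closed_walk n E w \<and> covers (set w) X}"
  by (simp add: STAR_def)

lemma VERTEX_COVER_feasible_nonempty:
  assumes "simple_graph n E"
  shows "feasible VERTEX_COVER (n, E) \<noteq> {}"
proof -
  have "e \<inter> {..<n} \<noteq> {}" if "e \<in> E" for e
  proof -
    have "e \<subseteq> {..<n}" "e \<noteq> {}"
      using that assms by (auto simp: simple_graph_def)
    then show ?thesis by auto
  qed
  then show ?thesis
    by (auto simp: feasible_VERTEX_COVER covers_def)
qed

text \<open>An optimal vertex cover is nonempty because there is an edge, and arranged as a closed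
  walk it is feasible for \<open>STAR\<close>.\<close>

lemma optimum_STAR_complete:
  assumes "simple_graph n E" "E \<noteq> {}"
  shows "feasible STAR (n, complete_graph n, E) \<noteq> {}"
    and "optimum STAR (n, complete_graph n, E) \<le> optimum VERTEX_COVER (n, E)"
    and "1 \<le> optimum VERTEX_COVER (n, E)"
proof -
  obtain S where S: "S \<subseteq> {..<n}" "covers S E" "card S = optimum VERTEX_COVER (n, E)"
    using optimum_attained[OF VERTEX_COVER_feasible_nonempty[OF assms(1)]]
    by (auto simp: feasible_VERTEX_COVER VERTEX_COVER_def)
  have "S \<noteq> {}"
    using S(2) assms(2) by (auto simp: covers_def)
  then obtain w where
    w: "closed_walk n (complete_graph n) w" "set w = S" "length w - 1 \<le> card S"
    using closed_walk_complete S(1) by blast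
  then have feas: "w \<in> feasible STAR (n, complete_graph n, E)"
    using S by (simp add: feasible_STAR)
  then show "feasible STAR (n, complete_graph n, E) \<noteq> {}"
    by blast
  show "optimum STAR (n, complete_graph n, E) \<le> optimum VERTEX_COVER (n, E)"
    using optimum_le[OF feas] w(3) S(3) by (simp add: STAR_def)
  show "1 \<le> optimum VERTEX_COVER (n, E)"
    using S \<open>S \<noteq> {}\<close> finite_subset[OF S(1)] card_gt_0_iff[of S] by simp
qed

lemma cover_of_walk:
  assumes "simple_graph n E" "E \<noteq> {}" "1 \<le> \<alpha>"
    and w: "w \<in> feasible STAR (n, complete_graph n, E)"
    and apx: "real (length w - 1) \<le> \<alpha> * real (optimum STAR (n, complete_graph n, E))"
  shows "set w \<in> feasible VERTEX_COVER (n, E)"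
    and "real (card (set w)) \<le> \<alpha> * real (optimum VERTEX_COVER (n, E))"
proof -
  let ?opt = "optimum VERTEX_COVER (n, E)"
  have walk: "closed_walk n (complete_graph n) w" "covers (set w) E"
    using w by (simp_all add: feasible_STAR)
  then show "set w \<in> feasible VERTEX_COVER (n, E)"
    by (simp add: feasible_VERTEX_COVER closed_walk_def)
  have "real (length w - 1) \<le> \<alpha> * real ?opt"
    using apx optimum_STAR_complete(2)[OF assms(1,2)] assms(3)
    by (meson mult_left_mono of_nat_le_iff order_trans zero_le_one)
  \<comment> \<open>This absorbs the walk of length 0, whose only vertex costs 1 as a cover.\<close>
  moreover have "1 \<le> \<alpha> * real ?opt"
    using optimum_STAR_complete(3)[OF assms(1,2)] assms(3) mult_mono[of 1 \<alpha> 1 "real ?opt"]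
    by simp
  moreover have "real (card (set w)) \<le> max 1 (real (length w - 1))"
    using card_closed_walk[OF walk(1)] by linarith
  ultimately show "real (card (set w)) \<le> \<alpha> * real ?opt"
    by linarith
qed

section \<open>Correctness and running time of the reduction\<close>

lemma poly_nat_mono: "x \<le> y \<Longrightarrow> poly p x \<le> poly p y" for p :: "nat poly"
  by (induction p) (auto intro: add_mono mult_mono)

lemma reduction_tm_correct:
  assumes "1 \<le> \<alpha>" "wf_tm M" "simple_graph n E"
    and bound: "\<forall>I \<in> instances STAR. \<exists>t \<le> poly p (length (instance_code STAR I)).
      halted M (run M (instance_code STAR I) t) \<and>
      (feasible STAR I \<noteq> {} \<longrightarrow>
        (\<exists>S \<in> feasible STAR I. \<exists>y \<in> solution_codes STAR S.
          has_output (run M (instance_code STAR I) t) y \<and>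
          real (cost STAR I S) \<le> \<alpha> * real (optimum STAR I)))"
  defines "x \<equiv> vertex_code n @ matrix_code n E"
  shows "\<exists>t \<le> 8 * length x + poly p (2 * length x).
    halted (reduction_tm M) (run (reduction_tm M) x t) \<and>
    (\<exists>S \<in> feasible VERTEX_COVER (n, E). \<exists>vs. set vs = S \<and>
      has_output (run (reduction_tm M) x t) (vertices_code vs) \<and>
      real (card S) \<le> \<alpha> * real (optimum VERTEX_COVER (n, E)))"
proof (cases "E = {}")
  case True
  have len: "length x = n + 1 + n * n"
    by (simp add: x_def vertex_code_def length_matrix_code)
  obtain t where t: "t \<le> n + n * n + 2" "halted (reduction_tm M) (run (reduction_tm M) x t)"
      "has_output (run (reduction_tm M) x t) []"
    using no_edge_halts[OF assms(2), of "matrix_code n E" n] matrix_code_edge[OF assms(3)] True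
    unfolding reaches_def run_def x_def length_matrix_code by auto
  have "{} \<in> feasible VERTEX_COVER (n, E)"
    using True by (simp add: feasible_VERTEX_COVER covers_def)
  \<comment> \<open>The empty word codes the empty list, hence the empty cover, of cost 0.\<close>
  moreover have "vertices_code [] = []"
    by (simp add: vertices_code_def)
  moreover have "t \<le> 8 * length x + poly p (2 * length x)"
    using t(1) len by simp
  ultimately show ?thesis
    using t assms(1)
    by (intro exI[of _ t] conjI bexI[of _ "{}"] exI[of _ "[]"]) simp_all
next
  case False
  let ?I = "(n, complete_graph n, E)"
  have len: "length x = n + 1 + n * n"
    by (simp add: x_def vertex_code_def length_matrix_code)
  obtain e where "e \<subseteq> {..<n}" "card e = 2"
    using False assms(3) by (auto simp: simple_graph_def)
  then have n: "2 \<le> n"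
    using card_mono[of "{..<n}" e] by simp
  have "?I \<in> instances STAR"
    using assms(3) False simple_graph_complete simple_graph_subset_complete
    by (simp add: STAR_def)
  then obtain s where s: "s \<le> poly p (length (instance_code STAR ?I))"
      "halted M (run M (instance_code STAR ?I) s)"
      "\<exists>S \<in> feasible STAR ?I. \<exists>y \<in> solution_codes STAR S.
        has_output (run M (instance_code STAR ?I) s) y \<and>
        real (cost STAR ?I S) \<le> \<alpha> * real (optimum STAR ?I)"
    using bound optimum_STAR_complete(1)[OF assms(3) False] by blast
  define z where "z = instance_code STAR ?I"
  have z: "z = vertex_code n @ False #
      concat (replicate (n - 1) (replicate n True @ [False])) @ matrix_code n E"
    using n matrix_code_complete[of n] by (simp add: z_def STAR_def)
  \<comment> \<open>Inserting one matrix at most doubles the length, whence the argument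
    \<open>2 * length x\<close>.\<close>
  have "length z = n + 1 + n * n + n * n"
    by (simp add: z_def STAR_def vertex_code_def length_matrix_code)
  then have s_le: "s \<le> poly p (2 * length x)"
    using s(1) poly_nat_mono[of "length z" "2 * length x" p] len by (simp add: z_def)
  obtain w where w: "w \<in> feasible STAR ?I" "has_output (run M z s) (vertices_code w)"
      "real (length w - 1) \<le> \<alpha> * real (optimum STAR ?I)"
    using s(3) by (auto simp: STAR_def z_def)
  obtain d u v r where r: "r \<le> 3 * n + 2 * (n * n) + 6 + n * (2 * n + 3)"
      "(step (reduction_tm M) ^^ r) (init_config (reduction_tm M) x)
        = embed_config d u v (init_config M z)"
    using edge_simulates[OF assms(2), of "matrix_code n E" n] n
      matrix_code_edge[OF assms(3)] False
    unfolding reaches_def x_def z length_matrix_code by auto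
  have run: "run (reduction_tm M) x (s + r) = embed_config d u v (run M z s)"
    using steps_embed_config[OF assms(2)] r(2) by (simp add: run_def funpow_add)
  have "length (snd (run M z s)) = tm_tapes M" "2 \<le> tm_tapes M"
    using wf_config_run[OF assms(2)] assms(2) by (auto simp: wf_config_def wf_tm_def)
  \<comment> \<open>The shift concerns only tape 0 and the counters come last, so tape 1 is the
    output tape of \<open>M\<close>.\<close>
  then have "snd (embed_config d u v (run M z s)) ! 1 = snd (run M z s) ! 1"
    by (cases "snd (run M z s)") (auto simp: embed_config_def nth_append)
  then have out: "has_output (run (reduction_tm M) x (s + r)) (vertices_code w)"
    using w(2) by (simp add: has_output_def run)
  have halt: "halted (reduction_tm M) (run (reduction_tm M) x (s + r))"
    using s(2) unfolding run by (simp add: halted_def embed_config_def z_def)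
  \<comment> \<open>Preprocessing takes at most \<open>4 * n * n + 6 * n + 6\<close> steps, which is
    below \<open>8 * length x\<close>.\<close>
  have "s + r \<le> 8 * length x + poly p (2 * length x)"
    using s_le r(1) unfolding len by (simp add: algebra_simps)
  then show ?thesis
    using out halt cover_of_walk[OF assms(3) False assms(1) w(1,3)] by blast
qed

theorem theorem2:
  fixes \<alpha> :: real
  assumes "\<alpha> \<ge> 1"
    and "has_poly_time_approx \<alpha> STAR"
  shows "has_poly_time_approx \<alpha> VERTEX_COVER"
proof -
  obtain M p where M: "wf_tm M"
    and bound: "\<forall>I \<in> instances STAR. \<exists>t \<le> poly p (length (instance_code STAR I)).
      halted M (run M (instance_code STAR I) t) \<and>
      (feasible STAR I \<noteq> {} \<longrightarrow>
        (\<exists>S \<in> feasible STAR I. \<exists>y \<in> solution_codes STAR S.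
          has_output (run M (instance_code STAR I) t) y \<and>
          real (cost STAR I S) \<le> \<alpha> * real (optimum STAR I)))"
    using assms(2) unfolding has_poly_time_approx_def poly_time_approx_algorithm_def by blast
  \<comment> \<open>Composition with \<open>[:0, 2:]\<close> evaluates \<open>p\<close> at twice the
    input length; \<open>[:0, 8:]\<close> pays for the preprocessing.\<close>
  define q where "q = [:0, 8:] + pcompose p [:0, 2:]"
  have q: "poly q m = 8 * m + poly p (2 * m)" for m
    by (simp add: q_def poly_pcompose mult.commute)
  have "\<exists>t \<le> poly q (length (instance_code VERTEX_COVER I)).
      halted (reduction_tm M) (run (reduction_tm M) (instance_code VERTEX_COVER I) t) \<and>
      (feasible VERTEX_COVER I \<noteq> {} \<longrightarrow>
        (\<exists>S \<in> feasible VERTEX_COVER I. \<exists>y \<in> solution_codes VERTEX_COVER S.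
          has_output (run (reduction_tm M) (instance_code VERTEX_COVER I) t) y \<and>
          real (cost VERTEX_COVER I S) \<le> \<alpha> * real (optimum VERTEX_COVER I)))"
    if I: "I \<in> instances VERTEX_COVER" for I
  proof -
    obtain n E where nE: "I = (n, E)" "simple_graph n E"
      using I by (auto simp: VERTEX_COVER_def)
    have sel: "instance_code VERTEX_COVER (n, E) = vertex_code n @ matrix_code n E"
      "solution_codes VERTEX_COVER S = {vertices_code vs | vs. set vs = S}"
      "cost VERTEX_COVER (n, E) S = card S" for S
      by (simp_all add: VERTEX_COVER_def)
    show ?thesis
      using reduction_tm_correct[OF assms(1) M nE(2) bound]
      unfolding nE(1) sel q by blast
  qed
  then show ?thesis
    using wf_reduction_tm[OF M]
    unfolding has_poly_time_approx_def poly_time_approx_algorithm_def by blast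
qed

end
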